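(* There is an absolute constant $C>0$ such that the following holds. Let $p$ be a prime, let $K,L$ be integers and $M,N$ positive integers with $\mathcal I=[K+1,K+M]\subseteq[1,p-1]$ and $\mathcal J=[L+1,L+N]\subseteq[1,p-1]$, and let $\{\alpha_m\}_{m\in\mathcal I}$ be arbitrary complex numbers. Then $$\left|\sum_{m\in\mathcal I}\sum_{n\in\mathcal J}\alpha_m\,\mathcal K_p(mn,1)\right|\le C\,\Big(\sum_{m\in\mathcal I}|\alpha_m|^2\Big)^{1/2} N^{1/2}\,p.$$
   Context: For a prime $p$ and integers $m,n$, the Kloosterman sum is $\mathcal K_p(m,n)=\sum_{x=1}^{p-1}\exp\!\big(2\pi i (mx+n\overline{x})/p\big)$, where $\overline{x}$ denotes the multiplicative inverse of $x$ modulo $p$. The sums over $m\in\mathcal I$, $n\in\mathcal J$ range over the integers in these intervals. (The paper states this for sufficiently large primes $p$ with an absolute implied constant.) *)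

theory Defs
  imports "HOL-Analysis.Analysis" "HOL-Number_Theory.Modular_Inverse"
begin

definition kloosterman_sum :: "nat \<Rightarrow> int \<Rightarrow> int \<Rightarrow> complex" where
  "kloosterman_sum p m n =
     (\<Sum>x = 1..int p - 1.
        exp (2 * of_real pi * \<i> * of_int (m * x + n * modular_inverse (int p) x) / of_nat p))"

end

theory Submission
  imports Defs
begin

text \<open>
  For \<open>n\<close> coprime to \<open>p\<close>, the substitution \<open>x \<mapsto> n x\<close> turns \<open>K(mn, 1)\<close> into \<open>K(m, n)\<close>.
  Hence the sum of \<open>K(mn, 1)\<close> over \<open>n\<close> is, as a function of \<open>m\<close>, the discrete Fourier
  transform of \<open>x \<mapsto> c(1/x)\<close>, where \<open>c(z)\<close> is the sum of \<open>exp (2 \<pi> i n z / p)\<close> over \<open>n\<close>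
  and so itself the Fourier transform of the indicator function of an interval of length \<open>N\<close>.
  Two applications of Parseval's identity bound its mean square over all residues \<open>m\<close> by
  \<open>N p\<^sup>2\<close>, and the Cauchy--Schwarz inequality gives the theorem with \<open>C = 1\<close>.
\<close>

definition additive_char :: "nat \<Rightarrow> int \<Rightarrow> complex" where
  "additive_char p a = cis (2 * pi * of_int a / of_nat p)"

lemma additive_char_add: "additive_char p (a + b) = additive_char p a * additive_char p b"
  by (simp add: additive_char_def cis_mult add_divide_distrib distrib_left)

lemma additive_char_diff: "additive_char p (a - b) = additive_char p a * cnj (additive_char p b)"
  by (simp add: additive_char_def cis_cnj cis_mult diff_divide_distrib right_diff_distrib)

text \<open>Turns a character sum over an initial segment of integers into a geometric
  progression.\<close>

lemma additive_char_of_nat_mult: "additive_char p (int k * a) = additive_char p a ^ k"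
  by (induction k) (simp_all add: distrib_right additive_char_add additive_char_def[of _ 0])

lemma additive_char_eq_1_iff:
  assumes "p > 0"
  shows "additive_char p a = 1 \<longleftrightarrow> int p dvd a"
proof -
  have "additive_char p a = 1 \<longleftrightarrow> (\<exists>k::int. 2 * pi * of_int a / of_nat p = of_int (2 * k) * pi)"
    by (simp add: additive_char_def cis_conv_exp exp_eq_1)
  also have "\<dots> \<longleftrightarrow> (\<exists>k::int. of_int a = (of_int (int p * k) :: real))"
    using assms by (simp add: field_simps)
  also have "\<dots> \<longleftrightarrow> int p dvd a"
    by (simp only: of_int_eq_iff dvd_def)
  finally show ?thesis .
qed

lemma additive_char_cong:
  assumes "p > 0" "[a = b] (mod int p)"
  shows "additive_char p a = additive_char p b"
proof -
  have "additive_char p (a - b) = 1"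
    using assms by (simp add: additive_char_eq_1_iff cong_iff_dvd_diff)
  then show ?thesis
    using additive_char_add[of p "a - b" b] by simp
qed

text \<open>A geometric sum whose ratio is a \<open>p\<close>-th root of unity: it vanishes unless
  the ratio is 1, which happens exactly when \<open>p\<close> divides \<open>a\<close>.\<close>

lemma sum_additive_char:
  assumes "p > 0"
  shows "(\<Sum>m\<in>{0..<int p}. additive_char p (m * a)) = (if int p dvd a then of_nat p else 0)"
proof -
  have "(\<Sum>m\<in>{0..<int p}. additive_char p (m * a)) = (\<Sum>k<p. additive_char p a ^ k)"
    by (rule sum.reindex_bij_witness[of _ int nat])
       (auto simp flip: additive_char_of_nat_mult)
  moreover have "additive_char p a ^ p = 1"
    using assms by (simp add: additive_char_eq_1_iff flip: additive_char_of_nat_mult)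
  ultimately show ?thesis
    using assms by (simp add: sum_gp_strict additive_char_eq_1_iff)
qed

text \<open>Write each square as a product with the conjugate, expand, and sum over \<open>m\<close>
  first. Orthogonality then removes every off-diagonal pair.\<close>

lemma parseval_additive_char:
  assumes "p > 0" "A \<subseteq> {0..<int p}"
  shows "(\<Sum>m\<in>{0..<int p}. (cmod (\<Sum>y\<in>A. c y * additive_char p (m * y)))\<^sup>2)
           = real p * (\<Sum>y\<in>A. (cmod (c y))\<^sup>2)"
proof -
  have fin: "finite A"
    using assms(2) finite_subset by blast
  \<comment> \<open>\<open>A\<close> lies within one period, so congruent elements of
    \<open>A\<close> are equal.\<close>
  have dvd: "int p dvd y - z \<longleftrightarrow> z = y" if "y \<in> A" "z \<in> A" for y z
  proof -
    have "y \<in> {0..<int p}" "z \<in> {0..<int p}"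
      using that assms(2) by auto
    then show ?thesis
      by (auto simp: mod_eq_dvd_iff[symmetric])
  qed
  have "complex_of_real (\<Sum>m\<in>{0..<int p}. (cmod (\<Sum>y\<in>A. c y * additive_char p (m * y)))\<^sup>2)
      = (\<Sum>m\<in>{0..<int p}. \<Sum>y\<in>A. \<Sum>z\<in>A. c y * cnj (c z) * additive_char p (m * (y - z)))"
    unfolding of_real_sum complex_norm_square cnj_sum sum_product
    by (intro sum.cong refl) (simp add: right_diff_distrib additive_char_diff)
  also have "\<dots> = (\<Sum>y\<in>A. \<Sum>m\<in>{0..<int p}. \<Sum>z\<in>A. c y * cnj (c z) * additive_char p (m * (y - z)))"
    by (rule sum.swap)
  also have "\<dots> = (\<Sum>y\<in>A. \<Sum>z\<in>A. \<Sum>m\<in>{0..<int p}. c y * cnj (c z) * additive_char p (m * (y - z)))"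
    by (rule sum.cong[OF refl], rule sum.swap)
  also have "\<dots> = (\<Sum>y\<in>A. \<Sum>z\<in>A. if z = y then of_nat p * (c y * cnj (c y)) else 0)"
    using assms(1) by (intro sum.cong refl)
      (simp add: sum_distrib_left[symmetric] sum_additive_char dvd)
  also have "\<dots> = complex_of_real (real p * (\<Sum>y\<in>A. (cmod (c y))\<^sup>2))"
    using fin by (simp add: complex_norm_square sum_distrib_left del: of_real_power)
  finally show ?thesis
    by (simp only: of_real_eq_iff)
qed

lemma coprime_int_less_prime:
  assumes "prime p" "x \<in> {1..<int p}"
  shows "coprime x (int p)"
proof -
  have "\<not> int p dvd x"
    using assms(2) by (simp add: zdvd_not_zless)
  then have "coprime (int p) x"
    using assms(1) by (intro prime_imp_coprime) simp_all
  then show ?thesis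
    by (simp add: coprime_commute)
qed

lemma kloosterman_sum_additive_char:
  "kloosterman_sum p m n
     = (\<Sum>x\<in>{1..<int p}. additive_char p (m * x + n * modular_inverse (int p) x))"
proof -
  have "{1..int p - 1} = {1..<int p}"
    by auto
  then show ?thesis
    by (simp add: kloosterman_sum_def additive_char_def cis_conv_exp mult_ac)
qed

text \<open>Multiplication by \<open>n\<close> permutes the nonzero residues. After the
  substitution, the factor \<open>n\<close> in front of the inverse cancels against the inverse of
  \<open>n\<close>.\<close>

lemma kloosterman_sum_mult_left:
  assumes "prime p" "coprime n (int p)"
  shows "kloosterman_sum p (m * n) 1 = kloosterman_sum p m n"
proof -
  have p: "p > 0"
    using assms(1) by (rule prime_gt_0_nat)
  let ?inv = "modular_inverse (int p)"
  have "kloosterman_sum p m n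
      = (\<Sum>x\<in>{1..<int p}. additive_char p (m * (n * x mod int p) + n * ?inv (n * x mod int p)))"
    unfolding kloosterman_sum_additive_char
    using sum.reindex_bij_betw[OF bij_betw_int_remainders_mult[OF assms(2)], symmetric] .
  also have "\<dots> = (\<Sum>x\<in>{1..<int p}. additive_char p (m * n * x + 1 * ?inv x))"
  proof (intro sum.cong refl additive_char_cong p cong_add)
    fix x assume x: "x \<in> {1..<int p}"
    then have cop: "coprime x (int p)"
      by (rule coprime_int_less_prime[OF assms(1)])
    show "[m * (n * x mod int p) = m * n * x] (mod int p)"
      by (simp add: cong_def mod_mult_right_eq mult.assoc)
    \<comment> \<open>The product of the inverses is reduced mod \<open>p\<close> because
      \<open>modular_inverse\<close> returns the representative in \<open>{0..<p}\<close>, and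
      uniqueness is applied there.\<close>
    have "?inv (n * x mod int p) = ?inv x * ?inv n mod int p"
    proof (rule modular_inverse_int_eqI)
      have "[n * x mod int p * (?inv x * ?inv n mod int p) = (n * ?inv n) * (x * ?inv x)] (mod int p)"
        by (simp add: cong_def mod_mult_eq mult_ac)
      also have "[(n * ?inv n) * (x * ?inv x) = 1 * 1] (mod int p)"
        by (intro cong_mult cong_modular_inverse1 assms(2) cop)
      finally show "[n * x mod int p * (?inv x * ?inv n mod int p) = 1] (mod int p)"
        by simp
    qed (use p in simp)
    then have "[n * ?inv (n * x mod int p) = (n * ?inv n) * ?inv x] (mod int p)"
      by (simp add: cong_def mod_mult_right_eq mult_ac)
    also have "[(n * ?inv n) * ?inv x = 1 * ?inv x] (mod int p)"
      by (intro cong_mult cong_modular_inverse1 assms(2) cong_refl)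
    finally show "[n * ?inv (n * x mod int p) = 1 * ?inv x] (mod int p)" .
  qed
  finally show ?thesis
    by (simp add: kloosterman_sum_additive_char)
qed

text \<open>Inversion is an involution on the nonzero residues.\<close>

lemma inj_on_modular_inverse:
  assumes "prime p"
  shows "inj_on (modular_inverse (int p)) {1..<int p}"
proof (rule inj_on_inverseI)
  fix x assume x: "x \<in> {1..<int p}"
  then have "coprime x (int p)"
    by (rule coprime_int_less_prime[OF assms])
  then show "modular_inverse (int p) (modular_inverse (int p) x) = x"
    using x by (intro modular_inverse_int_eqI cong_modular_inverse2) auto
qed

lemma kloosterman_sum_mean_square:
  assumes "prime p" "J \<subseteq> {1..<int p}"
  shows "(\<Sum>m\<in>{0..<int p}. (cmod (\<Sum>n\<in>J. kloosterman_sum p (m * n) 1))\<^sup>2)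
           \<le> real (card J) * (real p)\<^sup>2"
proof -
  have p: "p > 0"
    using assms(1) by (rule prime_gt_0_nat)
  let ?inv = "modular_inverse (int p)"
  \<comment> \<open>The coefficient 1 gives the sum the shape that
    \<open>parseval_additive_char\<close> expects.\<close>
  define c where "c z = (\<Sum>n\<in>J. 1 * additive_char p (z * n))" for z
  have K: "(\<Sum>n\<in>J. kloosterman_sum p (m * n) 1)
      = (\<Sum>x\<in>{1..<int p}. c (?inv x) * additive_char p (m * x))" for m
  proof -
    have "(\<Sum>n\<in>J. kloosterman_sum p (m * n) 1) = (\<Sum>n\<in>J. kloosterman_sum p m n)"
    proof (intro sum.cong refl kloosterman_sum_mult_left assms(1))
      fix n assume "n \<in> J"
      then show "coprime n (int p)"
        using assms by (intro coprime_int_less_prime) auto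
    qed
    also have "\<dots> = (\<Sum>x\<in>{1..<int p}. \<Sum>n\<in>J. additive_char p (m * x + n * ?inv x))"
      unfolding kloosterman_sum_additive_char by (rule sum.swap)
    finally show ?thesis
      by (simp add: c_def sum_distrib_right sum_distrib_left additive_char_add mult_ac)
  qed
  have "(\<Sum>x\<in>{1..<int p}. (cmod (c (?inv x)))\<^sup>2) = (\<Sum>z\<in>?inv ` {1..<int p}. (cmod (c z))\<^sup>2)"
    by (simp add: sum.reindex inj_on_modular_inverse assms(1))
  \<comment> \<open>Inverses lie in \<open>{0..<p}\<close>, so by positivity the sum may be enlarged
    to a full period, as Parseval requires for \<open>c\<close>.\<close>
  also have "\<dots> \<le> (\<Sum>z\<in>{0..<int p}. (cmod (c z))\<^sup>2)"
    using p by (intro sum_mono2) (auto simp: modular_inverse_int_nonneg modular_inverse_int_less)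
  also have "\<dots> = real p * real (card J)"
    unfolding c_def using assms(2) p by (subst parseval_additive_char) auto
  finally have "real p * (\<Sum>x\<in>{1..<int p}. (cmod (c (?inv x)))\<^sup>2) \<le> real p * (real p * real (card J))"
    by (rule mult_left_mono) simp
  \<comment> \<open>Parseval in \<open>m\<close>, with coefficients \<open>c (?inv x)\<close>,
    supplies the second factor \<open>p\<close>.\<close>
  then show ?thesis
    unfolding K using p by (subst parseval_additive_char) (auto simp: power2_eq_square mult_ac)
qed

text \<open>The triangle inequality and submultiplicativity of the norm reduce this to the real
  Cauchy--Schwarz inequality.\<close>

lemma norm_sum_mult_le_sqrt:
  fixes f g :: "'a \<Rightarrow> 'b::real_normed_algebra"
  shows "norm (\<Sum>i\<in>A. f i * g i) \<le> sqrt (\<Sum>i\<in>A. (norm (f i))\<^sup>2) * sqrt (\<Sum>i\<in>A. (norm (g i))\<^sup>2)"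
proof -
  have "norm (\<Sum>i\<in>A. f i * g i) \<le> (\<Sum>i\<in>A. \<bar>norm (f i)\<bar> * \<bar>norm (g i)\<bar>)"
    by (rule sum_norm_le) (simp add: norm_mult_ineq)
  also have "\<dots> \<le> L2_set (\<lambda>i. norm (f i)) A * L2_set (\<lambda>i. norm (g i)) A"
    by (rule L2_set_mult_ineq)
  finally show ?thesis
    by (simp add: L2_set_def)
qed

theorem theorem3p2:
  shows "\<exists>C::real. C > 0 \<and>
    (\<forall>(p::nat) (K::int) (L::int) (M::int) (N::int) (\<alpha> :: int \<Rightarrow> complex).
       prime p \<longrightarrow> M > 0 \<longrightarrow> N > 0 \<longrightarrow>
       {K+1..K+M} \<subseteq> {1..int p - 1} \<longrightarrow>
       {L+1..L+N} \<subseteq> {1..int p - 1} \<longrightarrow>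
       cmod (\<Sum>m\<in>{K+1..K+M}. \<Sum>n\<in>{L+1..L+N}. \<alpha> m * kloosterman_sum p (m * n) 1)
         \<le> C * sqrt (\<Sum>m\<in>{K+1..K+M}. (cmod (\<alpha> m))\<^sup>2) * sqrt (real_of_int N) * real p)"
proof (intro exI[of _ 1] conjI allI impI)
  fix p :: nat and K L M N :: int and \<alpha> :: "int \<Rightarrow> complex"
  assume p: "prime p" and N: "N > 0"
    and I: "{K+1..K+M} \<subseteq> {1..int p - 1}" and J: "{L+1..L+N} \<subseteq> {1..int p - 1}"
  define S where "S m = (\<Sum>n\<in>{L+1..L+N}. kloosterman_sum p (m * n) 1)" for m
  \<comment> \<open>Extending the range of \<open>m\<close> to all residues makes the mean square
    bound applicable; this is why the result does not depend on \<open>M\<close>.\<close>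
  have "(\<Sum>m\<in>{K+1..K+M}. (cmod (S m))\<^sup>2) \<le> (\<Sum>m\<in>{0..<int p}. (cmod (S m))\<^sup>2)"
    using I by (intro sum_mono2) force+
  also have "\<dots> \<le> real (card {L+1..L+N}) * (real p)\<^sup>2"
    unfolding S_def using J by (intro kloosterman_sum_mean_square p) force
  finally have "sqrt (\<Sum>m\<in>{K+1..K+M}. (cmod (S m))\<^sup>2) \<le> sqrt (real_of_int N * (real p)\<^sup>2)"
    using N by simp
  then have mean_square: "sqrt (\<Sum>m\<in>{K+1..K+M}. (cmod (S m))\<^sup>2) \<le> sqrt (real_of_int N) * real p"
    by (simp add: real_sqrt_mult)
  have "cmod (\<Sum>m\<in>{K+1..K+M}. \<alpha> m * S m)
      \<le> sqrt (\<Sum>m\<in>{K+1..K+M}. (cmod (\<alpha> m))\<^sup>2) * sqrt (\<Sum>m\<in>{K+1..K+M}. (cmod (S m))\<^sup>2)"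
    by (rule norm_sum_mult_le_sqrt)
  also have "\<dots> \<le> sqrt (\<Sum>m\<in>{K+1..K+M}. (cmod (\<alpha> m))\<^sup>2) * (sqrt (real_of_int N) * real p)"
    by (intro mult_left_mono mean_square real_sqrt_ge_zero sum_nonneg) simp
  finally show "cmod (\<Sum>m\<in>{K+1..K+M}. \<Sum>n\<in>{L+1..L+N}. \<alpha> m * kloosterman_sum p (m * n) 1)
      \<le> 1 * sqrt (\<Sum>m\<in>{K+1..K+M}. (cmod (\<alpha> m))\<^sup>2) * sqrt (real_of_int N) * real p"
    by (simp add: S_def sum_distrib_left mult.assoc)
qed simp

end
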